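(* Let $d\ge 1$ and, for $l=1,\dots,d$, let $\mathcal{A}_l$ be a linear BSP algorithm on $p_l\ge 1$ processors (indexed by $[p_l]$) computing a linear function $f_l: VI_{l}\to VJ_{l}$, with input distribution $[\phi_{l}^{s_l}\mid s_l\in[p_l]]$ of $I_l$ and output distribution $[\chi_{l}^{s_l}\mid s_l\in[p_l]]$ of $J_l$. Assume that $\mathcal{A}_1,\dots,\mathcal{A}_d$ have the same number and structure of supersteps, i.e. the same number $T$ of supersteps, and for each $t\in\{1,\dots,T\}$ the $t$-th supersteps of $\mathcal{A}_1,\dots,\mathcal{A}_d$ are either all computation supersteps or all communication supersteps. Then the following data define a linear BSP algorithm that computes $f_1\otimes\cdots\otimes f_d$, regarded as a linear function $V(I_1\times\cdots\times I_d)\to V(J_1\times\cdots\times J_d)$: (1) The processors are indexed by the $d$-dimensional grid $p:=[p_1]\times\cdots\times[p_d]$. At each stage, the local index set of processor $s=(s_1,\dots,s_d)\in p$ is the Cartesian product over $l$ of the local index sets at that stage of processor $s_l$ in $\mathcal{A}_l$. (2) The input distribution is $[\phi_1^{s_1}\times\cdots\times\phi_d^{s_d}\mid s\in p]$ and the output distribution is $[\chi_1^{s_1}\times\cdots\times\chi_d^{s_d}\mid s\in p]$. (3) If the $t$-th supersteps are computation supersteps, in which processor $s_l$ of $\mathcal{A}_l$ applies the linear function $g_l^{(s_l)}$ to its local array, then the $t$-th superstep of the combined algorithm is the computation superstep in which processor $s=(s_1,\dots,s_d)\in p$ applies $g_1^{(s_1)}\otimes\cdots\otimes g_d^{(s_d)}$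 to its local array. (4) If the $t$-th supersteps are communication supersteps, with that of $\mathcal{A}_l$ performing the permutation $$Z^{(\psi_l(s_l,k_l))}[\rho_l(s_l,k_l)] = X^{(s_l)}[k_l],$$ then the $t$-th superstep of the combined algorithm is the communication superstep performing the permutation $$Z^{((\psi_1\times\cdots\times\psi_d)(s,k))}\big[(\rho_1\times\cdots\times\rho_d)(s,k)\big] = X^{(s)}[k],$$ where for $s=(s_1,\dots,s_d)\in p$ and $k=(k_1,\dots,k_d)$ in the local index set of processor $s$, $$(\psi_1\times\cdots\times\psi_d)(s,k)=(\psi_1(s_1,k_1),\dots,\psi_d(s_d,k_d)),\qquad (\rho_1\times\cdots\times\rho_d)(s,k)=(\rho_1(s_1,k_1),\dots,\rho_d(s_d,k_d)).$$
   Context: Notation. $[n]=\{0,\dots,n-1\}$. All vector spaces are over $\mathbb{C}$. For a finite index set $I$, $VI$ is the free vector space with basis $I$, and for a map $r:I\to J$ of sets, $Vr:VI\to VJ$ is the linear map extending $r$ on basis elements. An array $X$ over $I$, with entries $X[k]\in\mathbb{C}$ for $k\in I$, is identified with the vector $\sum_{k\in I}X[k]\,k\in VI$. The canonical isomorphism $VI_1\otimes\cdots\otimes VI_d\cong V(I_1\times\cdots\times I_d)$, $k_1\otimes\cdots\otimes k_d\mapsto(k_1,\dots,k_d)$, is used to regard tensor products of linear maps $VI_l\to VJ_l$ as linear maps $V(I_1\times\cdots\times I_d)\to V(J_1\times\cdots\times J_d)$. Distributed arrays. Let $P$ be a finite set of processor indices ($P=[p]$ for a one-dimensional set of processors, or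 a product $[p_1]\times\cdots\times[p_d]$ for a processor grid). Given local index sets $(I^{(s)})_{s\in P}$, a distributed array is a family $(X^{(s)})_{s\in P}$ with $X^{(s)}$ an array over $I^{(s)}$; equivalently, it is an element of $\bigoplus_{s\in P}VI^{(s)}\cong V\coprod_{s\in P}I^{(s)}$. Elements of $\coprod_{s\in P}I^{(s)}$ are written $(s,k)$ with $k\in I^{(s)}$. Distribution. A distribution of an index set $I$ over $P$ consists of local index sets $(I^{(s)})_{s\in P}$ and functions $\phi^s:I^{(s)}\to I$ such that the induced function $[\phi^s\mid s\in P]:\coprod_{s\in P}I^{(s)}\to I$, $(s,k)\mapsto\phi^s(k)$, is bijective. It relates a global array $X$ over $I$ to its local arrays by $X^{(s)}[k]=X[\phi^s(k)]$. Linear BSP algorithm. A linear BSP algorithm over $P$ computing a linear function $f:VI\to VJ$ consists of an input distribution of $I$ over $P$, an output distribution of $J$ over $P$, and a finite sequence of supersteps acting successively on distributed arrays. It starts with the local index sets of the input distribution and ends with those of the output distribution. Each superstep is of one of two kinds: - Computation superstep: given linear functions $g^{(s)}:VI^{(s)}\to VK^{(s)}$ for $s\in P$, where $I^{(s)}$ are the current local index sets and $K^{(s)}$ the next ones, each processor $s$ replaces its local array $X^{(s)}$ by $g^{(s)}(X^{(s)})$. - Communication superstep: given a permutation (bijection to itself) $r$ of $\coprod_{s\in P}I^{(s)}$, written $r(s,k)=(\psi(s,k),\rho(s,k))$ with $\psi(s,k)\in P$ and $\rho(s,k)\in I^{(\psi(s,k))}$, the distributed array $X$ is replaced by the distributed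 array $Z=(Vr)(X)$, i.e. $Z^{(\psi(s,k))}[\rho(s,k)]=X^{(s)}[k]$ for all $(s,k)$. The algorithm computes $f$ if, for every $x\in VI$, applying all supersteps in order to the distributed array corresponding to $x$ under the input distribution yields the distributed array corresponding to $f(x)$ under the output distribution. *)

theory Defs
  imports Complex_Main "HOL-Library.FuncSet" "HOL-Library.Indicator_Function"
begin

section \<open>Free vector spaces on finite index sets\<close>

text \<open>
  An array over \<open>I\<close> is a function that vanishes outside \<open>I\<close>, so that equality of arrays is equality
  of functions. The basis element \<open>k\<close> is \<open>indicator {k}\<close>.
\<close>

definition free_space :: "'i set \<Rightarrow> ('i \<Rightarrow> complex) set" where
  "free_space I = {x. \<forall>k. k \<notin> I \<longrightarrow> x k = 0}"

text \<open>The values of a linear map outside \<open>free_space I\<close> are irrelevant.\<close>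

definition linear_fun ::
  "'i set \<Rightarrow> 'j set \<Rightarrow> (('i \<Rightarrow> complex) \<Rightarrow> 'j \<Rightarrow> complex) \<Rightarrow> bool" where
  "linear_fun I J f \<longleftrightarrow>
     (\<forall>x\<in>free_space I. f x \<in> free_space J) \<and>
     (\<forall>x\<in>free_space I. \<forall>y\<in>free_space I. f (\<lambda>k. x k + y k) = (\<lambda>j. f x j + f y j)) \<and>
     (\<forall>c. \<forall>x\<in>free_space I. f (\<lambda>k. c * x k) = (\<lambda>j. c * f x j))"

lemma free_space_expand:
  assumes "finite I" "x \<in> free_space I"
  shows "x = (\<lambda>j. \<Sum>k\<in>I. x k * indicator {k} j)"
proof
  fix j
  have "(\<Sum>k\<in>I. x k * indicator {k} j) = (\<Sum>k\<in>I. if k = j then x j else 0)"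
    by (intro sum.cong) (auto simp: indicator_def)
  also have "\<dots> = x j"
    using assms by (auto simp: free_space_def)
  finally show "x j = (\<Sum>k\<in>I. x k * indicator {k} j)" ..
qed

lemma linear_fun_expand:
  assumes f: "linear_fun I J f" and "finite I" and x: "x \<in> free_space I"
  shows "f x = (\<lambda>j. \<Sum>k\<in>I. x k * f (indicator {k}) j)"
proof -
  have f_add: "f (\<lambda>k. y k + z k) = (\<lambda>j. f y j + f z j)"
    if "y \<in> free_space I" "z \<in> free_space I" for y z
    using f that by (simp add: linear_fun_def)
  have f_scale: "f (\<lambda>k. c * y k) = (\<lambda>j. c * f y j)" if "y \<in> free_space I" for c y
    using f that by (simp add: linear_fun_def)
  have "(\<lambda>j. \<Sum>k\<in>S. x k * indicator {k} j) \<in> free_space I \<and>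
      f (\<lambda>j. \<Sum>k\<in>S. x k * indicator {k} j) = (\<lambda>j. \<Sum>k\<in>S. x k * f (indicator {k}) j)"
    if "finite S" "S \<subseteq> I" for S
    using that
  proof (induction S)
    case empty
    have "(\<lambda>_. 0) \<in> free_space I"
      by (simp add: free_space_def)
    with f_scale[OF this, of 0] show ?case by simp
  next
    case (insert a S)
    let ?y = "\<lambda>j. \<Sum>k\<in>S. x k * indicator {k} j"
    have y: "?y \<in> free_space I"
      and fy: "f ?y = (\<lambda>j. \<Sum>k\<in>S. x k * f (indicator {k}) j)"
      using insert by auto
    have e: "indicator {a} \<in> free_space I" and ae: "(\<lambda>j. x a * indicator {a} j) \<in> free_space I"
      using insert.prems by (auto simp: free_space_def indicator_def)
    have "f (\<lambda>j. x a * indicator {a} j + ?y j) = (\<lambda>j. f (\<lambda>j. x a * indicator {a} j) j + f ?y j)"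
      by (rule f_add[OF ae y])
    moreover have "f (\<lambda>j. x a * indicator {a} j) = (\<lambda>j. x a * f (indicator {a}) j)"
      by (rule f_scale[OF e])
    moreover have "(\<lambda>j. x a * indicator {a} j + ?y j) \<in> free_space I"
      using ae y by (simp add: free_space_def)
    ultimately show ?case
      using insert.hyps fy by simp
  qed
  from this[of I] show ?thesis
    using assms free_space_expand[OF \<open>finite I\<close> x] by simp
qed

text \<open>The map \<open>Vr\<close>, i.e. the linear extension of \<open>r\<close>, on arrays over \<open>I\<close>.\<close>

definition free_map :: "'i set \<Rightarrow> ('i \<Rightarrow> 'j) \<Rightarrow> ('i \<Rightarrow> complex) \<Rightarrow> 'j \<Rightarrow> complex" where
  "free_map I r x = (\<lambda>j. \<Sum>k\<in>I. x k * indicator {r k} j)"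


section \<open>Tensor products\<close>

text \<open>
  The product \<open>I\<^sub>1 \<times> \<dots> \<times> I\<^sub>d\<close> is \<open>PiE {1..d} I\<close>, and the tensor product of the spaces
  \<open>free_space (I l)\<close> is identified with \<open>free_space (PiE {1..d} I)\<close>: \<open>tensor_vec\<close> is the image of
  the pure tensor under this identification, and \<open>tensor_map\<close> is the linear map that sends the basis
  element \<open>(k\<^sub>1, \<dots>, k\<^sub>d)\<close> to the tensor product of the vectors \<open>f\<^sub>l(k\<^sub>l)\<close>.
\<close>

definition tensor_vec :: "nat \<Rightarrow> (nat \<Rightarrow> 'i \<Rightarrow> complex) \<Rightarrow> (nat \<Rightarrow> 'i) \<Rightarrow> complex" where
  "tensor_vec d x = (\<lambda>k. if k \<in> extensional {1..d} then \<Prod>l\<in>{1..d}. x l (k l) else 0)"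

definition tensor_map ::
  "nat \<Rightarrow> (nat \<Rightarrow> 'i set) \<Rightarrow> (nat \<Rightarrow> ('i \<Rightarrow> complex) \<Rightarrow> 'j \<Rightarrow> complex) \<Rightarrow>
    ((nat \<Rightarrow> 'i) \<Rightarrow> complex) \<Rightarrow> (nat \<Rightarrow> 'j) \<Rightarrow> complex" where
  "tensor_map d I f x =
     (\<lambda>j. \<Sum>k\<in>PiE {1..d} I. x k * tensor_vec d (\<lambda>l. f l (indicator {k l})) j)"

text \<open>The usual characterization of the tensor product of linear maps, on pure tensors.\<close>

lemma tensor_map_tensor_vec:
  assumes "\<And>l. l \<in> {1..d} \<Longrightarrow> finite (I l)"
    and "\<And>l. l \<in> {1..d} \<Longrightarrow> linear_fun (I l) (J l) (f l)"
    and "\<And>l. l \<in> {1..d} \<Longrightarrow> x l \<in> free_space (I l)"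
  shows "tensor_map d I f (tensor_vec d x) = tensor_vec d (\<lambda>l. f l (x l))"
proof
  fix j :: "nat \<Rightarrow> 'b"
  show "tensor_map d I f (tensor_vec d x) j = tensor_vec d (\<lambda>l. f l (x l)) j"
  proof (cases "j \<in> extensional {1..d}")
    case False
    then show ?thesis by (simp add: tensor_map_def tensor_vec_def)
  next
    case True
    have "tensor_map d I f (tensor_vec d x) j =
        (\<Sum>k\<in>PiE {1..d} I. \<Prod>l\<in>{1..d}. x l (k l) * f l (indicator {k l}) (j l))"
      unfolding tensor_map_def tensor_vec_def prod.distrib
      using True by (intro sum.cong) (auto simp: PiE_def)
    also have "\<dots> = (\<Prod>l\<in>{1..d}. \<Sum>k\<in>I l. x l k * f l (indicator {k}) (j l))"
      using assms(1)
      by (intro prod_sum_PiE[of "{1..d}" I "\<lambda>l k. x l k * f l (indicator {k}) (j l)", symmetric]) auto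
    also have "\<dots> = (\<Prod>l\<in>{1..d}. f l (x l) (j l))"
      using assms by (intro prod.cong refl) (metis linear_fun_expand)
    finally show ?thesis
      using True by (simp add: tensor_vec_def)
  qed
qed


section \<open>Distributed arrays and distributions\<close>

text \<open>
  A distributed array with local index sets \<open>L s\<close>, \<open>s \<in> P\<close>, is a family \<open>X\<close> with
  \<open>X s \<in> free_space (L s)\<close> for \<open>s \<in> P\<close>; it is set to zero for \<open>s \<notin> P\<close>. Uncurrying it gives the
  corresponding element of \<open>free_space (Sigma P L)\<close>.
\<close>

definition distribution ::
  "'p set \<Rightarrow> ('p \<Rightarrow> 'k set) \<Rightarrow> ('p \<Rightarrow> 'k \<Rightarrow> 'i) \<Rightarrow> 'i set \<Rightarrow> bool" where
  "distribution P L \<phi> I \<longleftrightarrow> bij_betw (\<lambda>(s, k). \<phi> s k) (Sigma P L) I"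

definition distribute ::
  "'p set \<Rightarrow> ('p \<Rightarrow> 'k set) \<Rightarrow> ('p \<Rightarrow> 'k \<Rightarrow> 'i) \<Rightarrow> ('i \<Rightarrow> complex) \<Rightarrow> 'p \<Rightarrow> 'k \<Rightarrow> complex" where
  "distribute P L \<phi> x = (\<lambda>s k. if s \<in> P \<and> k \<in> L s then x (\<phi> s k) else 0)"


section \<open>Linear BSP algorithms\<close>

datatype ('p, 'k) superstep =
    is_Comp: Comp (comp_fun: "'p \<Rightarrow> ('k \<Rightarrow> complex) \<Rightarrow> 'k \<Rightarrow> complex")
  | is_Comm: Comm (comm_perm: "'p \<times> 'k \<Rightarrow> 'p \<times> 'k")

text \<open>
  The stages are numbered \<open>0, \<dots>, num_steps\<close>; superstep \<open>t < num_steps\<close> leads from stage \<open>t\<close> to stage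
  \<open>Suc t\<close>. The local index sets of the input and output distributions are those of the first and last
  stage.
\<close>

record ('p, 'i, 'j, 'k) bsp_alg =
  num_steps :: nat
  local_idx :: "nat \<Rightarrow> 'p \<Rightarrow> 'k set"
  in_map :: "'p \<Rightarrow> 'k \<Rightarrow> 'i"
  out_map :: "'p \<Rightarrow> 'k \<Rightarrow> 'j"
  sstep :: "nat \<Rightarrow> ('p, 'k) superstep"

fun valid_superstep ::
  "'p set \<Rightarrow> ('p \<Rightarrow> 'k set) \<Rightarrow> ('p \<Rightarrow> 'k set) \<Rightarrow> ('p, 'k) superstep \<Rightarrow> bool" where
  "valid_superstep P L K (Comp g) \<longleftrightarrow> (\<forall>s\<in>P. linear_fun (L s) (K s) (g s))"
| "valid_superstep P L K (Comm r) \<longleftrightarrow>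
     (\<forall>s\<in>P. K s = L s) \<and> bij_betw r (Sigma P L) (Sigma P L)"

fun apply_superstep ::
  "'p set \<Rightarrow> ('p \<Rightarrow> 'k set) \<Rightarrow> ('p, 'k) superstep \<Rightarrow>
    ('p \<Rightarrow> 'k \<Rightarrow> complex) \<Rightarrow> 'p \<Rightarrow> 'k \<Rightarrow> complex" where
  "apply_superstep P L (Comp g) X = (\<lambda>s. if s \<in> P then g s (X s) else (\<lambda>_. 0))"
| "apply_superstep P L (Comm r) X = curry (free_map (Sigma P L) r (case_prod X))"

text \<open>The entrywise description of a communication superstep.\<close>

lemma apply_superstep_Comm:
  assumes "finite (Sigma P L)" "bij_betw r (Sigma P L) (Sigma P L)" "s \<in> P" "k \<in> L s"
  shows "apply_superstep P L (Comm r) X (fst (r (s, k))) (snd (r (s, k))) = X s k"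
proof -
  have "apply_superstep P L (Comm r) X (fst (r (s, k))) (snd (r (s, k))) =
      (\<Sum>q\<in>Sigma P L. case_prod X q * indicator {r q} (r (s, k)))"
    by (simp add: free_map_def curry_def)
  also have "\<dots> = (\<Sum>q\<in>Sigma P L. if q = (s, k) then case_prod X q else 0)"
    using assms by (intro sum.cong refl) (auto simp: indicator_def dest: inj_onD[OF bij_betw_imp_inj_on])
  also have "\<dots> = X s k"
    using assms by simp
  finally show ?thesis .
qed

primrec run_bsp ::
  "'p set \<Rightarrow> ('p, 'i, 'j, 'k) bsp_alg \<Rightarrow> nat \<Rightarrow>
    ('p \<Rightarrow> 'k \<Rightarrow> complex) \<Rightarrow> 'p \<Rightarrow> 'k \<Rightarrow> complex" where
  "run_bsp P A 0 X = X"
| "run_bsp P A (Suc t) X = apply_superstep P (local_idx A t) (sstep A t) (run_bsp P A t X)"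

definition linear_bsp ::
  "'p set \<Rightarrow> 'i set \<Rightarrow> 'j set \<Rightarrow> ('p, 'i, 'j, 'k) bsp_alg \<Rightarrow> bool" where
  "linear_bsp P I J A \<longleftrightarrow>
     finite P \<and> finite I \<and> finite J \<and>
     (\<forall>t\<le>num_steps A. \<forall>s\<in>P. finite (local_idx A t s)) \<and>
     distribution P (local_idx A 0) (in_map A) I \<and>
     distribution P (local_idx A (num_steps A)) (out_map A) J \<and>
     (\<forall>t<num_steps A. valid_superstep P (local_idx A t) (local_idx A (Suc t)) (sstep A t))"

definition computes ::
  "'p set \<Rightarrow> 'i set \<Rightarrow> 'j set \<Rightarrow> ('p, 'i, 'j, 'k) bsp_alg \<Rightarrow>
    (('i \<Rightarrow> complex) \<Rightarrow> 'j \<Rightarrow> complex) \<Rightarrow> bool" where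
  "computes P I J A f \<longleftrightarrow>
     linear_bsp P I J A \<and> linear_fun I J f \<and>
     (\<forall>x\<in>free_space I.
        run_bsp P A (num_steps A) (distribute P (local_idx A 0) (in_map A) x) =
        distribute P (local_idx A (num_steps A)) (out_map A) (f x))"


section \<open>The combined algorithm\<close>

text \<open>
  The two cases are the only ones when all algorithms have the same kind of superstep at \<open>t\<close>.
\<close>

definition tensor_step ::
  "nat \<Rightarrow> (nat \<Rightarrow> ('p, 'i, 'j, 'k) bsp_alg) \<Rightarrow> nat \<Rightarrow> (nat \<Rightarrow> 'p, nat \<Rightarrow> 'k) superstep" where
  "tensor_step d A t =
     (if \<forall>l\<in>{1..d}. is_Comp (sstep (A l) t)
      then Comp (\<lambda>s. tensor_map d (\<lambda>l. local_idx (A l) t (s l)) (\<lambda>l. comp_fun (sstep (A l) t) (s l)))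
      else Comm (\<lambda>(s, k). (\<lambda>l\<in>{1..d}. fst (comm_perm (sstep (A l) t) (s l, k l)),
                           \<lambda>l\<in>{1..d}. snd (comm_perm (sstep (A l) t) (s l, k l)))))"

definition tensor_bsp ::
  "nat \<Rightarrow> nat \<Rightarrow> (nat \<Rightarrow> ('p, 'i, 'j, 'k) bsp_alg) \<Rightarrow>
    (nat \<Rightarrow> 'p, nat \<Rightarrow> 'i, nat \<Rightarrow> 'j, nat \<Rightarrow> 'k) bsp_alg" where
  "tensor_bsp d T A =
     \<lparr>num_steps = T,
      local_idx = (\<lambda>t s. PiE {1..d} (\<lambda>l. local_idx (A l) t (s l))),
      in_map = (\<lambda>s k. \<lambda>l\<in>{1..d}. in_map (A l) (s l) (k l)),
      out_map = (\<lambda>s k. \<lambda>l\<in>{1..d}. out_map (A l) (s l) (k l)),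
      sstep = tensor_step d A\<rparr>"

end

theory Submission
  imports Defs
begin

text \<open>
  A linear BSP algorithm acts linearly on distributed arrays, so it suffices to follow a basis element
  of \<open>V(I\<^sub>1 \<times> \<dots> \<times> I\<^sub>d)\<close>. This is a pure tensor of basis elements, and each combined superstep sends
  the pure tensor of distributed arrays \<open>X\<^sub>1, \<dots>, X\<^sub>d\<close> to the pure tensor of their images under the
  supersteps of the single algorithms. For communication this holds because \<open>\<Coprod>\<^sub>s \<Prod>\<^sub>l I\<^sub>l\<^bsup>(s\<^sub>l)\<^esup>\<close> is
  in bijection with \<open>\<Prod>\<^sub>l \<Coprod>\<^sub>s I\<^sub>l\<^bsup>(s)\<^esup>\<close>, which turns the combined permutation into the product of the
  given permutations.
\<close>

section \<open>Bijections between products and disjoint unions of index sets\<close>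

lemma bij_betw_PiE_map:
  assumes "\<And>l. l \<in> A \<Longrightarrow> bij_betw (h l) (B l) (C l)"
  shows "bij_betw (\<lambda>x. \<lambda>l\<in>A. h l (x l)) (PiE A B) (PiE A C)"
proof (rule bij_betw_byWitness[where f' = "\<lambda>y. \<lambda>l\<in>A. inv_into (B l) (h l) (y l)"])
  show "\<forall>x\<in>PiE A B. (\<lambda>l\<in>A. inv_into (B l) (h l) ((\<lambda>l\<in>A. h l (x l)) l)) = x"
    by (auto simp: fun_eq_iff PiE_iff extensional_def bij_betw_inv_into_left[OF assms])
  show "\<forall>y\<in>PiE A C. (\<lambda>l\<in>A. h l ((\<lambda>l\<in>A. inv_into (B l) (h l) (y l)) l)) = y"
    by (auto simp: fun_eq_iff PiE_iff extensional_def bij_betw_inv_into_right[OF assms])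
  show "(\<lambda>x. \<lambda>l\<in>A. h l (x l)) ` PiE A B \<subseteq> PiE A C"
    using assms by (fastforce simp: bij_betw_def)
  show "(\<lambda>y. \<lambda>l\<in>A. inv_into (B l) (h l) (y l)) ` PiE A C \<subseteq> PiE A B"
    using assms by (auto simp: bij_betw_def PiE_iff intro!: inv_into_into)
qed

text \<open>Both components are restricted to \<open>A\<close>, so that they are extensional and can
  lie in products \<open>PiE A _\<close>.\<close>

definition unzip_on :: "'l set \<Rightarrow> ('l \<Rightarrow> 'a \<times> 'b) \<Rightarrow> ('l \<Rightarrow> 'a) \<times> ('l \<Rightarrow> 'b)" where
  "unzip_on A q = (\<lambda>l\<in>A. fst (q l), \<lambda>l\<in>A. snd (q l))"

text \<open>The target is the index set of distributed arrays over the grid. Bijections and sums on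
  it can thus be transported to a product over \<open>l\<close>, each factor of which concerns a
  single algorithm.\<close>

lemma bij_betw_unzip_on:
  "bij_betw (unzip_on A) (PiE A (\<lambda>l. Sigma (P l) (L l)))
     (Sigma (PiE A P) (\<lambda>s. PiE A (\<lambda>l. L l (s l))))"
proof (rule bij_betw_byWitness[where f' = "\<lambda>(s, k). \<lambda>l\<in>A. (s l, k l)"])
  show "\<forall>q\<in>PiE A (\<lambda>l. Sigma (P l) (L l)). (\<lambda>(s, k). \<lambda>l\<in>A. (s l, k l)) (unzip_on A q) = q"
    by (auto simp: unzip_on_def fun_eq_iff PiE_def extensional_def)
  show "\<forall>q\<in>Sigma (PiE A P) (\<lambda>s. PiE A (\<lambda>l. L l (s l))). unzip_on A ((\<lambda>(s, k). \<lambda>l\<in>A. (s l, k l)) q) = q"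
    by (auto simp: unzip_on_def fun_eq_iff PiE_def extensional_def)
  show "unzip_on A ` PiE A (\<lambda>l. Sigma (P l) (L l)) \<subseteq> Sigma (PiE A P) (\<lambda>s. PiE A (\<lambda>l. L l (s l)))"
    by (auto simp: unzip_on_def PiE_iff dest!: bspec)
  show "(\<lambda>(s, k). \<lambda>l\<in>A. (s l, k l)) ` Sigma (PiE A P) (\<lambda>s. PiE A (\<lambda>l. L l (s l)))
      \<subseteq> PiE A (\<lambda>l. Sigma (P l) (L l))"
    by auto
qed

text \<open>Precomposed with \<open>unzip_on\<close>, the combined map is the product of the
  uncurried maps \<open>case_prod (\<phi> l)\<close>, which are bijections by assumption.\<close>

lemma distribution_PiE:
  assumes "\<And>l. l \<in> A \<Longrightarrow> distribution (P l) (L l) (\<phi> l) (I l)"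
  shows "distribution (PiE A P) (\<lambda>s. PiE A (\<lambda>l. L l (s l)))
           (\<lambda>s k. \<lambda>l\<in>A. \<phi> l (s l) (k l)) (PiE A I)"
  unfolding distribution_def
proof (subst bij_betw_comp_iff[OF bij_betw_unzip_on])
  have "bij_betw (\<lambda>q. \<lambda>l\<in>A. case_prod (\<phi> l) (q l)) (PiE A (\<lambda>l. Sigma (P l) (L l))) (PiE A I)"
    using assms by (intro bij_betw_PiE_map) (auto simp: distribution_def)
  then show "bij_betw ((\<lambda>(s, k). \<lambda>l\<in>A. \<phi> l (s l) (k l)) \<circ> unzip_on A)
      (PiE A (\<lambda>l. Sigma (P l) (L l))) (PiE A I)"
    by (rule iffD1[OF bij_betw_cong, rotated]) (auto simp: unzip_on_def fun_eq_iff case_prod_beta)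
qed

text \<open>This is the map in the communication case of \<open>tensor_step\<close>, written through
  \<open>unzip_on\<close> so that it can be conjugated into a componentwise map.\<close>

definition perm_PiE ::
  "'l set \<Rightarrow> ('l \<Rightarrow> 'a \<times> 'b \<Rightarrow> 'c \<times> 'd) \<Rightarrow> ('l \<Rightarrow> 'a) \<times> ('l \<Rightarrow> 'b) \<Rightarrow> ('l \<Rightarrow> 'c) \<times> ('l \<Rightarrow> 'd)" where
  "perm_PiE A r = (\<lambda>(s, k). unzip_on A (\<lambda>l. r l (s l, k l)))"

lemma perm_PiE_unzip_on: "perm_PiE A r (unzip_on A q) = unzip_on A (\<lambda>l\<in>A. r l (q l))"
  by (auto simp: perm_PiE_def unzip_on_def fun_eq_iff)

lemma bij_betw_perm_PiE:
  assumes "\<And>l. l \<in> A \<Longrightarrow> bij_betw (r l) (Sigma (P l) (L l)) (Sigma (P l) (L l))"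
  shows "bij_betw (perm_PiE A r) (Sigma (PiE A P) (\<lambda>s. PiE A (\<lambda>l. L l (s l))))
           (Sigma (PiE A P) (\<lambda>s. PiE A (\<lambda>l. L l (s l))))"
proof (subst bij_betw_comp_iff[OF bij_betw_unzip_on])
  show "bij_betw (perm_PiE A r \<circ> unzip_on A) (PiE A (\<lambda>l. Sigma (P l) (L l)))
      (Sigma (PiE A P) (\<lambda>s. PiE A (\<lambda>l. L l (s l))))"
    using bij_betw_trans[OF bij_betw_PiE_map[OF assms] bij_betw_unzip_on]
    by (simp add: comp_def perm_PiE_unzip_on)
qed

section \<open>Linear maps and their tensor products\<close>

lemma linear_fun_sum:
  assumes f: "linear_fun I J f" and "finite S" and "\<And>i. i \<in> S \<Longrightarrow> x i \<in> free_space I"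
  shows "f (\<lambda>k. \<Sum>i\<in>S. c i * x i k) = (\<lambda>j. \<Sum>i\<in>S. c i * f (x i) j)"
  using assms(2,3)
proof (induction S)
  case empty
  \<comment> \<open>The empty sum is a multiple by 0, so \<open>f\<close> sends it to 0 by
    homogeneity.\<close>
  have "f (\<lambda>k. 0 * y k) = (\<lambda>j. 0 * f y j)" if "y \<in> free_space I" for y
    using f that by (simp only: linear_fun_def)
  from this[of "\<lambda>_. 0"] show ?case
    by (simp add: free_space_def)
next
  case (insert a S)
  have a: "(\<lambda>k. c a * x a k) \<in> free_space I" and S: "(\<lambda>k. \<Sum>i\<in>S. c i * x i k) \<in> free_space I"
    using insert.prems by (auto simp: free_space_def)
  have "f (\<lambda>k. \<Sum>i\<in>insert a S. c i * x i k) = f (\<lambda>k. c a * x a k + (\<Sum>i\<in>S. c i * x i k))"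
    using insert.hyps by simp
  also have "\<dots> = (\<lambda>j. f (\<lambda>k. c a * x a k) j + f (\<lambda>k. \<Sum>i\<in>S. c i * x i k) j)"
    using f a S by (simp add: linear_fun_def)
  also have "f (\<lambda>k. c a * x a k) = (\<lambda>j. c a * f (x a) j)"
    using f insert.prems by (simp add: linear_fun_def)
  finally show ?case
    using insert by simp
qed

text \<open>Additivity and homogeneity can be read off the defining sum; the content is that the
  image is supported in the product of the \<open>J l\<close>.\<close>

lemma linear_fun_tensor_map:
  assumes "\<And>l. l \<in> {1..d} \<Longrightarrow> linear_fun (I l) (J l) (f l)"
  shows "linear_fun (PiE {1..d} I) (PiE {1..d} J) (tensor_map d I f)"
  unfolding linear_fun_def
proof (intro conjI ballI allI)
  fix x assume "x \<in> free_space (PiE {1..d} I)"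
  \<comment> \<open>An extensional \<open>j\<close> outside the product has a component outside
    \<open>J l\<close>, which makes one factor vanish; for other \<open>j\<close> the default value
    of \<open>tensor_vec\<close> is 0.\<close>
  have "tensor_vec d (\<lambda>l. f l (indicator {k l})) j = 0"
    if k: "k \<in> PiE {1..d} I" and j: "j \<notin> PiE {1..d} J" for k j
  proof (cases "j \<in> extensional {1..d}")
    case True
    with j obtain l where l: "l \<in> {1..d}" "j l \<notin> J l"
      unfolding PiE_iff by blast
    have "indicator {k l} \<in> free_space (I l)"
      using k l by (auto simp: free_space_def indicator_def)
    then have "f l (indicator {k l}) (j l) = 0"
      using assms[OF l(1)] l(2) by (auto simp: linear_fun_def free_space_def)
    then show ?thesis
      using l True by (auto simp: tensor_vec_def intro!: prod_zero)
  qed (simp add: tensor_vec_def)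
  then show "tensor_map d I f x \<in> free_space (PiE {1..d} J)"
    by (simp add: free_space_def tensor_map_def)
qed (auto simp: tensor_map_def sum.distrib sum_distrib_left algebra_simps)

text \<open>An extensional \<open>j\<close> different from \<open>k\<close> differs from it at some
  \<open>l\<close> in the range, where the factor is 0; a non-extensional \<open>j\<close> differs
  from \<open>k\<close> and gets the default value 0.\<close>

lemma indicator_eq_tensor_vec:
  assumes "k \<in> extensional {1..d}"
  shows "indicator {k} = tensor_vec d (\<lambda>l. indicator {k l})"
proof
  fix j
  show "indicator {k} j = tensor_vec d (\<lambda>l. indicator {k l}) j"
  proof (cases "j \<in> extensional {1..d} \<and> j \<noteq> k")
    case True
    then obtain l where "l \<in> {1..d}" "j l \<noteq> k l"
      using assms by (metis extensionalityI)
    then have "(\<Prod>l\<in>{1..d}. indicator {k l} (j l)) = (0::complex)"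
      by (intro prod_zero bexI[of _ l]) auto
    with True show ?thesis
      by (simp add: tensor_vec_def)
  qed (use assms in \<open>auto simp: tensor_vec_def indicator_def\<close>)
qed

section \<open>Linearity of supersteps and runs on distributed arrays\<close>

text \<open>The curried form of \<open>free_space (Sigma P L)\<close>. Vanishing for
  \<open>s\<close> outside \<open>P\<close> matches the defaults of \<open>distribute\<close> and
  \<open>apply_superstep\<close>.\<close>

definition dist_space :: "'p set \<Rightarrow> ('p \<Rightarrow> 'k set) \<Rightarrow> ('p \<Rightarrow> 'k \<Rightarrow> complex) set" where
  "dist_space P L = {X. \<forall>s k. (s, k) \<notin> Sigma P L \<longrightarrow> X s k = 0}"

lemma dist_space_free_space: "X \<in> dist_space P L \<Longrightarrow> s \<in> P \<Longrightarrow> X s \<in> free_space (L s)"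
  by (simp add: dist_space_def free_space_def)

lemma distribute_in_dist_space: "distribute P L \<phi> x \<in> dist_space P L"
  by (auto simp: dist_space_def distribute_def)

lemma distribute_sum:
  "distribute P L \<phi> (\<lambda>j. \<Sum>i\<in>S. c i * x i j) = (\<lambda>s k. \<Sum>i\<in>S. c i * distribute P L \<phi> (x i) s k)"
  by (auto simp: distribute_def fun_eq_iff)

lemma apply_superstep_in_dist_space:
  assumes "valid_superstep P L K st" and X: "X \<in> dist_space P L"
  shows "apply_superstep P L st X \<in> dist_space P K"
proof (cases st)
  case (Comp g)
  have "g s (X s) \<in> free_space (K s)" if "s \<in> P" for s
    using assms that Comp dist_space_free_space[OF X that] by (auto simp: linear_fun_def)
  then show ?thesis
    using Comp by (auto simp: dist_space_def free_space_def)
next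
  case (Comm r)
  have K: "Sigma P K = Sigma P L" and r: "r ` Sigma P L = Sigma P L"
    using assms(1) Comm by (auto simp: bij_betw_def)
  \<comment> \<open>Since \<open>r\<close> maps \<open>Sigma P L\<close> onto itself, no entry is
    moved to a position outside it.\<close>
  have "indicator {r q} j = (0::complex)" if "j \<notin> Sigma P L" "q \<in> Sigma P L" for j q
    using r that by (auto simp: indicator_def simp del: mem_Sigma_iff)
  then show ?thesis
    unfolding Comm dist_space_def K by (simp add: free_map_def del: mem_Sigma_iff)
qed

text \<open>Computation is linear processor by processor; for communication the sum in
  \<open>free_map\<close> is interchanged with the sum over \<open>S\<close>.\<close>

lemma apply_superstep_sum:
  assumes "valid_superstep P L K st" "finite S" and X: "\<And>i. i \<in> S \<Longrightarrow> X i \<in> dist_space P L"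
  shows "apply_superstep P L st (\<lambda>s k. \<Sum>i\<in>S. c i * X i s k) =
           (\<lambda>s k. \<Sum>i\<in>S. c i * apply_superstep P L st (X i) s k)"
proof (cases st)
  case (Comp g)
  have "g s (\<lambda>k. \<Sum>i\<in>S. c i * X i s k) = (\<lambda>j. \<Sum>i\<in>S. c i * g s (X i s) j)" if "s \<in> P" for s
    using assms(1,2) that Comp dist_space_free_space[OF X]
    by (intro linear_fun_sum[where I = "L s" and J = "K s"]) auto
  then show ?thesis
    using Comp by (auto simp: fun_eq_iff)
next
  case (Comm r)
  have "(\<Sum>q\<in>Sigma P L. (\<Sum>i\<in>S. c i * X i (fst q) (snd q)) * indicator {r q} j) =
      (\<Sum>i\<in>S. c i * (\<Sum>q\<in>Sigma P L. X i (fst q) (snd q) * indicator {r q} j))" for j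
    unfolding sum_distrib_left sum_distrib_right
    by (subst sum.swap) (simp add: mult.assoc)
  then show ?thesis
    using Comm by (simp add: fun_eq_iff free_map_def case_prod_beta)
qed

lemma run_bsp_in_dist_space:
  assumes "linear_bsp P I J A" "X \<in> dist_space P (local_idx A 0)" "t \<le> num_steps A"
  shows "run_bsp P A t X \<in> dist_space P (local_idx A t)"
  using assms(3)
proof (induction t)
  case (Suc t)
  then have "valid_superstep P (local_idx A t) (local_idx A (Suc t)) (sstep A t)"
    using assms(1) by (simp add: linear_bsp_def)
  then show ?case
    using Suc apply_superstep_in_dist_space by fastforce
qed (simp add: assms)

text \<open>Linearity of single supersteps is iterated, with \<open>run_bsp_in_dist_space\<close>
  keeping the intermediate arrays in the right space. This reduces the correctness of a run to basis
  elements.\<close>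

lemma run_bsp_sum:
  assumes A: "linear_bsp P I J A" and "finite S"
    and X: "\<And>i. i \<in> S \<Longrightarrow> X i \<in> dist_space P (local_idx A 0)" and "t \<le> num_steps A"
  shows "run_bsp P A t (\<lambda>s k. \<Sum>i\<in>S. c i * X i s k) =
           (\<lambda>s k. \<Sum>i\<in>S. c i * run_bsp P A t (X i) s k)"
  using assms(4)
proof (induction t)
  case (Suc t)
  then have "valid_superstep P (local_idx A t) (local_idx A (Suc t)) (sstep A t)"
    using A by (simp add: linear_bsp_def)
  then show ?case
    using Suc run_bsp_in_dist_space[OF A X] \<open>finite S\<close> by (simp add: apply_superstep_sum)
qed simp

section \<open>Supersteps on pure tensors of distributed arrays\<close>

text \<open>The explicit 0 outside the grid matters because
  \<open>tensor_vec d (\<lambda>l. X l (s l))\<close> sees only the components of \<open>s\<close>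
  in \<open>{1..d}\<close> and so cannot detect a non-extensional \<open>s\<close>.\<close>

definition tensor_dist ::
  "nat \<Rightarrow> (nat \<Rightarrow> 'p set) \<Rightarrow> (nat \<Rightarrow> 'p \<Rightarrow> 'k \<Rightarrow> complex) \<Rightarrow> (nat \<Rightarrow> 'p) \<Rightarrow> (nat \<Rightarrow> 'k) \<Rightarrow> complex" where
  "tensor_dist d P X =
     (\<lambda>s k. if s \<in> PiE {1..d} P then tensor_vec d (\<lambda>l. X l (s l)) k else 0)"

lemma tensor_dist_cong:
  assumes "\<And>l. l \<in> {1..d} \<Longrightarrow> X l = Y l"
  shows "tensor_dist d P X = tensor_dist d P Y"
  using assms by (auto simp: tensor_dist_def tensor_vec_def fun_eq_iff intro!: prod.cong)

lemma distribute_tensor_vec: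
  "distribute (PiE {1..d} P) (\<lambda>s. PiE {1..d} (\<lambda>l. L l (s l)))
     (\<lambda>s k. \<lambda>l\<in>{1..d}. \<phi> l (s l) (k l)) (tensor_vec d x) =
   tensor_dist d P (\<lambda>l. distribute (P l) (L l) (\<phi> l) (x l))" (is "?D = ?R")
proof (intro ext)
  fix s k
  \<comment> \<open>In the first case both sides take their default 0. In the second the left side
    is 0 because \<open>k\<close> leaves the product of local index sets, the right side because its
    factor at \<open>l\<close> is 0. In the third the factors agree one by one.\<close>
  consider "s \<notin> PiE {1..d} P \<or> k \<notin> extensional {1..d}"
    | l where "s \<in> PiE {1..d} P" "k \<in> extensional {1..d}" "l \<in> {1..d}" "k l \<notin> L l (s l)"
    | "s \<in> PiE {1..d} P" "k \<in> PiE {1..d} (\<lambda>l. L l (s l))"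
    unfolding PiE_iff[of k] by blast
  then show "?D s k = ?R s k"
  proof cases
    case 1
    then show ?thesis
      by (auto simp: distribute_def tensor_dist_def tensor_vec_def PiE_def)
  next
    case 2
    then have "(\<Prod>l\<in>{1..d}. distribute (P l) (L l) (\<phi> l) (x l) (s l) (k l)) = 0"
      by (auto simp: distribute_def intro!: prod_zero)
    moreover have "k \<notin> PiE {1..d} (\<lambda>l. L l (s l))"
      using 2 by auto
    ultimately show ?thesis
      by (simp add: distribute_def tensor_dist_def tensor_vec_def)
  next
    case 3
    then have "(\<Prod>l\<in>{1..d}. distribute (P l) (L l) (\<phi> l) (x l) (s l) (k l)) =
        (\<Prod>l\<in>{1..d}. x l (\<phi> l (s l) (k l)))"
      by (intro prod.cong) (auto simp: distribute_def)
    then show ?thesis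
      using 3 by (simp add: distribute_def tensor_dist_def tensor_vec_def PiE_def)
  qed
qed

text \<open>On each grid processor a tensor product of linear maps acts on a pure tensor, which is
  \<open>tensor_map_tensor_vec\<close>.\<close>

lemma apply_superstep_Comp_tensor:
  assumes fin: "\<And>l s. l \<in> {1..d} \<Longrightarrow> s \<in> P l \<Longrightarrow> finite (L l s)"
    and valid: "\<And>l. l \<in> {1..d} \<Longrightarrow> valid_superstep (P l) (L l) (K l) (Comp (g l))"
    and X: "\<And>l. l \<in> {1..d} \<Longrightarrow> X l \<in> dist_space (P l) (L l)"
  shows "apply_superstep (PiE {1..d} P) LL
           (Comp (\<lambda>s. tensor_map d (\<lambda>l. L l (s l)) (\<lambda>l. g l (s l)))) (tensor_dist d P X) =
         tensor_dist d P (\<lambda>l. apply_superstep (P l) (L l) (Comp (g l)) (X l))"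
proof
  fix s
  show "apply_superstep (PiE {1..d} P) LL
           (Comp (\<lambda>s. tensor_map d (\<lambda>l. L l (s l)) (\<lambda>l. g l (s l)))) (tensor_dist d P X) s =
         tensor_dist d P (\<lambda>l. apply_superstep (P l) (L l) (Comp (g l)) (X l)) s"
  proof (cases "s \<in> PiE {1..d} P")
    case True
    have "tensor_map d (\<lambda>l. L l (s l)) (\<lambda>l. g l (s l)) (tensor_vec d (\<lambda>l. X l (s l))) =
        tensor_vec d (\<lambda>l. g l (s l) (X l (s l)))"
      using True fin valid dist_space_free_space[OF X]
      by (intro tensor_map_tensor_vec[where J = "\<lambda>l. K l (s l)"]) (auto simp: PiE_mem)
    also have "\<dots> = tensor_vec d (\<lambda>l. apply_superstep (P l) (L l) (Comp (g l)) (X l) (s l))"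
      using True by (auto simp: tensor_vec_def fun_eq_iff PiE_mem intro!: prod.cong)
    finally show ?thesis
      using True by (simp add: tensor_dist_def)
  qed (simp add: tensor_dist_def)
qed

text \<open>An entry of the left side is a sum over index pairs of the grid. Reindexed by
  \<open>unzip_on\<close>, it runs over a product of sets \<open>Sigma (P l) (L l)\<close>, on which
  array entry and indicator both factor over \<open>l\<close>; distributivity
  (\<open>prod_sum_PiE\<close>) then gives the product of the single sums.\<close>

lemma apply_superstep_Comm_tensor:
  assumes fin: "\<And>l. l \<in> {1..d} \<Longrightarrow> finite (Sigma (P l) (L l))"
    and valid: "\<And>l. l \<in> {1..d} \<Longrightarrow> valid_superstep (P l) (L l) (K l) (Comm (r l))"
  shows "apply_superstep (PiE {1..d} P) (\<lambda>s. PiE {1..d} (\<lambda>l. L l (s l)))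
           (Comm (perm_PiE {1..d} r)) (tensor_dist d P X) =
         tensor_dist d P (\<lambda>l. apply_superstep (P l) (L l) (Comm (r l)) (X l))"
proof (intro ext)
  fix s' k'
  let ?Q = "PiE {1..d} (\<lambda>l. Sigma (P l) (L l))"
  let ?S = "Sigma (PiE {1..d} P) (\<lambda>s. PiE {1..d} (\<lambda>l. L l (s l)))"
  let ?Y = "\<lambda>l. apply_superstep (P l) (L l) (Comm (r l)) (X l)"
  let ?L = "apply_superstep (PiE {1..d} P) (\<lambda>s. PiE {1..d} (\<lambda>l. L l (s l)))
           (Comm (perm_PiE {1..d} r)) (tensor_dist d P X) s' k'"
  have bij: "bij_betw (r l) (Sigma (P l) (L l)) (Sigma (P l) (L l))" if "l \<in> {1..d}" for l
    using valid[OF that] by simp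
  have "?L = (\<Sum>q\<in>?S. case_prod (tensor_dist d P X) q * indicator {perm_PiE {1..d} r q} (s', k'))"
    by (simp add: free_map_def)
  also have "\<dots> = (\<Sum>q\<in>?Q. case_prod (tensor_dist d P X) (unzip_on {1..d} q) *
      indicator {perm_PiE {1..d} r (unzip_on {1..d} q)} (s', k'))"
    by (rule sum.reindex_bij_betw[OF bij_betw_unzip_on, symmetric])
  also have "\<dots> = (\<Sum>q\<in>?Q. (\<Prod>l\<in>{1..d}. case_prod (X l) (q l)) *
      indicator {unzip_on {1..d} (\<lambda>l\<in>{1..d}. r l (q l))} (s', k'))"
  proof (intro sum.cong refl arg_cong2[where f = "(*)"])
    fix q assume "q \<in> ?Q"
    then have "unzip_on {1..d} q \<in> ?S"
      using bij_betw_apply[OF bij_betw_unzip_on] by blast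
    then show "case_prod (tensor_dist d P X) (unzip_on {1..d} q) = (\<Prod>l\<in>{1..d}. case_prod (X l) (q l))"
      by (auto simp: unzip_on_def tensor_dist_def tensor_vec_def case_prod_beta intro!: prod.cong)
  qed (simp add: perm_PiE_unzip_on)
  finally have L: "?L = (\<Sum>q\<in>?Q. (\<Prod>l\<in>{1..d}. case_prod (X l) (q l)) *
      indicator {unzip_on {1..d} (\<lambda>l\<in>{1..d}. r l (q l))} (s', k'))" .
  show "?L = tensor_dist d P ?Y s' k'"
  \<comment> \<open>In the negative case \<open>(s', k')\<close> lies outside \<open>?S\<close>,
    hence is not hit by the permutation. The positive case also includes \<open>k'\<close> outside
    the local index sets, since the factorization holds there as well.\<close>
  proof (cases "s' \<in> PiE {1..d} P \<and> k' \<in> extensional {1..d}")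
    case False
    have "unzip_on {1..d} (\<lambda>l\<in>{1..d}. r l (q l)) \<noteq> (s', k')" if "q \<in> ?Q" for q
    proof -
      have "(\<lambda>l\<in>{1..d}. r l (q l)) \<in> ?Q"
        by (rule bij_betw_apply[OF bij_betw_PiE_map[OF bij] that])
      then have "unzip_on {1..d} (\<lambda>l\<in>{1..d}. r l (q l)) \<in> ?S"
        using bij_betw_apply[OF bij_betw_unzip_on] by blast
      then show ?thesis
        using False by (auto simp: PiE_def)
    qed
    then have "?L = 0"
      unfolding L by (intro sum.neutral ballI) (metis indicator_simps(2) mult_zero_right singletonD)
    then show ?thesis
      using False by (auto simp: tensor_dist_def tensor_vec_def)
  next
    case True
    let ?q = "\<lambda>l\<in>{1..d}. (s' l, k' l)"
    have "indicator {unzip_on {1..d} (\<lambda>l\<in>{1..d}. r l (q l))} (s', k') =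
        (\<Prod>l\<in>{1..d}. indicator {r l (q l)} (s' l, k' l) :: complex)" for q
    proof -
      \<comment> \<open>All tuples involved are extensional, so equality is decided by the
        components in \<open>{1..d}\<close>, and the indicator of the pair is the product of the
        componentwise indicators.\<close>
      have "(s', k') = unzip_on {1..d} (\<lambda>l\<in>{1..d}. r l (q l)) \<longleftrightarrow>
          (\<forall>l\<in>{1..d}. (s' l, k' l) = r l (q l))"
        using True
        by (auto simp: unzip_on_def prod_eq_iff fun_eq_iff PiE_def extensional_def
              split: if_splits)
      then show ?thesis
        by (auto simp: indicator_def intro!: prod_zero)
    qed
    then have "?L = (\<Sum>q\<in>?Q. \<Prod>l\<in>{1..d}. case_prod (X l) (q l) * indicator {r l (q l)} (s' l, k' l))"
      unfolding L prod.distrib by simp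
    also have "\<dots> = (\<Prod>l\<in>{1..d}. \<Sum>q\<in>Sigma (P l) (L l). case_prod (X l) q * indicator {r l q} (s' l, k' l))"
      using fin by (intro prod_sum_PiE[symmetric]) auto
    also have "\<dots> = tensor_dist d P ?Y s' k'"
      using True by (simp add: tensor_dist_def tensor_vec_def free_map_def)
    finally show ?thesis .
  qed
qed

section \<open>Correctness of one combined superstep\<close>

text \<open>A single communication superstep falsifies the guard of \<open>tensor_step\<close>; the
  result is put in the form for which bijectivity and action on pure tensors are
  established.\<close>

lemma tensor_step_Comm:
  assumes "\<exists>l\<in>{1..d}. is_Comm (sstep (A l) t)"
  shows "tensor_step d A t = Comm (perm_PiE {1..d} (\<lambda>l. comm_perm (sstep (A l) t)))"
proof -
  have "\<not> (\<forall>l\<in>{1..d}. is_Comp (sstep (A l) t))"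
    using assms superstep.distinct_disc by blast
  then have "tensor_step d A t = Comm (\<lambda>(s, k).
      (\<lambda>l\<in>{1..d}. fst (comm_perm (sstep (A l) t) (s l, k l)),
       \<lambda>l\<in>{1..d}. snd (comm_perm (sstep (A l) t) (s l, k l))))"
    unfolding tensor_step_def by (rule if_not_P)
  then show ?thesis
    by (simp add: perm_PiE_def unzip_on_def)
qed

lemma tensor_step_correct:
  assumes "d \<ge> 1"
    and valid: "\<And>l. l \<in> {1..d} \<Longrightarrow> valid_superstep (P l) (local_idx (A l) t) (K l) (sstep (A l) t)"
    and kind: "(\<forall>l\<in>{1..d}. is_Comp (sstep (A l) t)) \<or> (\<forall>l\<in>{1..d}. is_Comm (sstep (A l) t))"
    and finP: "\<And>l. l \<in> {1..d} \<Longrightarrow> finite (P l)"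
    and fin: "\<And>l s. l \<in> {1..d} \<Longrightarrow> s \<in> P l \<Longrightarrow> finite (local_idx (A l) t s)"
  shows "valid_superstep (PiE {1..d} P) (\<lambda>s. PiE {1..d} (\<lambda>l. local_idx (A l) t (s l)))
           (\<lambda>s. PiE {1..d} (\<lambda>l. K l (s l))) (tensor_step d A t)" (is ?valid)
    and "\<forall>l\<in>{1..d}. X l \<in> dist_space (P l) (local_idx (A l) t) \<Longrightarrow>
         apply_superstep (PiE {1..d} P) (\<lambda>s. PiE {1..d} (\<lambda>l. local_idx (A l) t (s l)))
           (tensor_step d A t) (tensor_dist d P X) =
         tensor_dist d P (\<lambda>l. apply_superstep (P l) (local_idx (A l) t) (sstep (A l) t) (X l))"
      (is "_ \<Longrightarrow> ?apply = ?rhs")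
proof -
  have "?valid \<and> ((\<forall>l\<in>{1..d}. X l \<in> dist_space (P l) (local_idx (A l) t)) \<longrightarrow> ?apply = ?rhs)"
    using kind
  proof
    assume comp: "\<forall>l\<in>{1..d}. is_Comp (sstep (A l) t)"
    define g where "g l = comp_fun (sstep (A l) t)" for l
    have g: "sstep (A l) t = Comp (g l)" if "l \<in> {1..d}" for l
      using comp that by (simp add: g_def)
    have step: "tensor_step d A t =
        Comp (\<lambda>s. tensor_map d (\<lambda>l. local_idx (A l) t (s l)) (\<lambda>l. g l (s l)))"
      unfolding tensor_step_def g_def using comp by (rule if_P)
    \<comment> \<open>The kind of superstep is known only for \<open>l\<close> in
      \<open>{1..d}\<close>, so the replacement by \<open>Comp (g l)\<close> goes through
      \<open>tensor_dist_cong\<close>.\<close>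
    have "?rhs = tensor_dist d P (\<lambda>l. apply_superstep (P l) (local_idx (A l) t) (Comp (g l)) (X l))"
      by (rule tensor_dist_cong) (simp only: g)
    moreover have valid': "valid_superstep (P l) (local_idx (A l) t) (K l) (Comp (g l))"
      if "l \<in> {1..d}" for l
      using valid[OF that] g[OF that] by simp
    moreover have ?valid
      unfolding step valid_superstep.simps
      using valid' by (intro ballI linear_fun_tensor_map) (auto simp: PiE_mem)
    ultimately show ?thesis
      unfolding step using fin apply_superstep_Comp_tensor[of d P "\<lambda>l. local_idx (A l) t" K g X]
      by simp
  next
    assume comm: "\<forall>l\<in>{1..d}. is_Comm (sstep (A l) t)"
    define r where "r l = comm_perm (sstep (A l) t)" for l
    have r: "sstep (A l) t = Comm (r l)" if "l \<in> {1..d}" for l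
      using comm that by (simp add: r_def)
    \<comment> \<open>Here \<open>d \<ge> 1\<close> enters: over an empty range the guard of
      \<open>tensor_step\<close> would hold vacuously and yield a computation superstep.\<close>
    have "\<exists>l\<in>{1..d}. is_Comm (sstep (A l) t)"
      using comm \<open>d \<ge> 1\<close> by force
    from tensor_step_Comm[OF this] have step: "tensor_step d A t = Comm (perm_PiE {1..d} r)"
      by (simp add: r_def[abs_def])
    have "?rhs = tensor_dist d P (\<lambda>l. apply_superstep (P l) (local_idx (A l) t) (Comm (r l)) (X l))"
      by (rule tensor_dist_cong) (simp only: r)
    moreover have valid': "valid_superstep (P l) (local_idx (A l) t) (K l) (Comm (r l))"
      if "l \<in> {1..d}" for l
      using valid[OF that] r[OF that] by simp
    moreover have ?valid
      unfolding step valid_superstep.simps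
      using valid' by (auto intro!: bij_betw_perm_PiE PiE_cong simp: PiE_mem)
    moreover have "finite (Sigma (P l) (local_idx (A l) t))" if "l \<in> {1..d}" for l
      using finP[OF that] fin[OF that] by auto
    ultimately show ?thesis
      unfolding step using apply_superstep_Comm_tensor[of d P "\<lambda>l. local_idx (A l) t" K r X] by simp
  qed
  then show ?valid and "\<forall>l\<in>{1..d}. X l \<in> dist_space (P l) (local_idx (A l) t) \<Longrightarrow> ?apply = ?rhs"
    by auto
qed

section \<open>Validity and correctness of the combined algorithm\<close>

lemma linear_bsp_tensor_bsp:
  assumes "d \<ge> 1"
    and A: "\<And>l. l \<in> {1..d} \<Longrightarrow> linear_bsp (P l) (I l) (J l) (A l)"
    and T: "\<And>l. l \<in> {1..d} \<Longrightarrow> num_steps (A l) = T"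
    and kind: "\<And>t. t < T \<Longrightarrow>
      (\<forall>l\<in>{1..d}. is_Comp (sstep (A l) t)) \<or> (\<forall>l\<in>{1..d}. is_Comm (sstep (A l) t))"
  shows "linear_bsp (PiE {1..d} P) (PiE {1..d} I) (PiE {1..d} J) (tensor_bsp d T A)"
  unfolding linear_bsp_def
proof (intro conjI allI impI ballI)
  show "finite (PiE {1..d} P)" "finite (PiE {1..d} I)" "finite (PiE {1..d} J)"
    using A by (auto intro!: finite_PiE simp: linear_bsp_def)
  show "finite (local_idx (tensor_bsp d T A) t s)"
    if "t \<le> num_steps (tensor_bsp d T A)" "s \<in> PiE {1..d} P" for t s
    using A T that by (auto intro!: finite_PiE simp: tensor_bsp_def linear_bsp_def PiE_mem)
  show "distribution (PiE {1..d} P) (local_idx (tensor_bsp d T A) 0)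
      (in_map (tensor_bsp d T A)) (PiE {1..d} I)"
    using A distribution_PiE[of "{1..d}" P "\<lambda>l. local_idx (A l) 0" "\<lambda>l. in_map (A l)" I]
    by (simp add: tensor_bsp_def linear_bsp_def)
  show "distribution (PiE {1..d} P) (local_idx (tensor_bsp d T A) (num_steps (tensor_bsp d T A)))
      (out_map (tensor_bsp d T A)) (PiE {1..d} J)"
    using A T distribution_PiE[of "{1..d}" P "\<lambda>l. local_idx (A l) T" "\<lambda>l. out_map (A l)" J]
    by (simp add: tensor_bsp_def linear_bsp_def)
  show "valid_superstep (PiE {1..d} P) (local_idx (tensor_bsp d T A) t)
      (local_idx (tensor_bsp d T A) (Suc t)) (sstep (tensor_bsp d T A) t)"
    if "t < num_steps (tensor_bsp d T A)" for t
  proof -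
    have t: "t < T"
      using that by (simp add: tensor_bsp_def)
    have "valid_superstep (PiE {1..d} P) (\<lambda>s. PiE {1..d} (\<lambda>l. local_idx (A l) t (s l)))
        (\<lambda>s. PiE {1..d} (\<lambda>l. local_idx (A l) (Suc t) (s l))) (tensor_step d A t)"
      using A T t by (intro tensor_step_correct(1) \<open>d \<ge> 1\<close> kind) (auto simp: linear_bsp_def)
    then show ?thesis
      by (simp add: tensor_bsp_def)
  qed
qed

text \<open>Induction on the number of executed supersteps: \<open>run_bsp_in_dist_space\<close>
  shows that the arrays reached by each \<open>A l\<close> are admissible for
  \<open>tensor_step_correct\<close>.\<close>

lemma run_bsp_tensor_dist:
  assumes "d \<ge> 1"
    and A: "\<And>l. l \<in> {1..d} \<Longrightarrow> linear_bsp (P l) (I l) (J l) (A l)"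
    and T: "\<And>l. l \<in> {1..d} \<Longrightarrow> num_steps (A l) = T"
    and kind: "\<And>t. t < T \<Longrightarrow>
      (\<forall>l\<in>{1..d}. is_Comp (sstep (A l) t)) \<or> (\<forall>l\<in>{1..d}. is_Comm (sstep (A l) t))"
    and X: "\<And>l. l \<in> {1..d} \<Longrightarrow> X l \<in> dist_space (P l) (local_idx (A l) 0)"
    and "t \<le> T"
  shows "run_bsp (PiE {1..d} P) (tensor_bsp d T A) t (tensor_dist d P X) =
           tensor_dist d P (\<lambda>l. run_bsp (P l) (A l) t (X l))"
  using \<open>t \<le> T\<close>
proof (induction t)
  case (Suc t)
  have "run_bsp (P l) (A l) t (X l) \<in> dist_space (P l) (local_idx (A l) t)" if "l \<in> {1..d}" for l
    using run_bsp_in_dist_space[OF A X] T Suc.prems that by simp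
  then have "apply_superstep (PiE {1..d} P) (\<lambda>s. PiE {1..d} (\<lambda>l. local_idx (A l) t (s l)))
      (tensor_step d A t) (tensor_dist d P (\<lambda>l. run_bsp (P l) (A l) t (X l))) =
      tensor_dist d P (\<lambda>l. run_bsp (P l) (A l) (Suc t) (X l))"
    unfolding run_bsp.simps using A T Suc.prems
    \<comment> \<open>The equation determines only stage \<open>t\<close>; \<open>K\<close> is
      chosen as the next stage, for which validity of the supersteps is known.\<close>
    by (intro tensor_step_correct(2)[where K = "\<lambda>l. local_idx (A l) (Suc t)"] \<open>d \<ge> 1\<close> kind)
      (auto simp: linear_bsp_def)
  with Suc show ?case
    by (simp add: tensor_bsp_def)
qed simp

text \<open>The grid is built from arbitrary processor sets; the intervals \<open>{..<p l}\<close>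
  are substituted only at the end.\<close>

lemma computes_tensor_bsp:
  assumes "d \<ge> 1"
    and comp: "\<And>l. l \<in> {1..d} \<Longrightarrow> computes (P l) (I l) (J l) (A l) (f l)"
    and T: "\<And>l. l \<in> {1..d} \<Longrightarrow> num_steps (A l) = T"
    and kind: "\<And>t. t < T \<Longrightarrow>
      (\<forall>l\<in>{1..d}. is_Comp (sstep (A l) t)) \<or> (\<forall>l\<in>{1..d}. is_Comm (sstep (A l) t))"
  shows "computes (PiE {1..d} P) (PiE {1..d} I) (PiE {1..d} J) (tensor_bsp d T A) (tensor_map d I f)"
  unfolding computes_def
proof (intro conjI ballI)
  let ?P = "PiE {1..d} P" and ?I = "PiE {1..d} I" and ?B = "tensor_bsp d T A"
  have A: "linear_bsp (P l) (I l) (J l) (A l)" if "l \<in> {1..d}" for l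
    using comp[OF that] by (simp add: computes_def)
  show B: "linear_bsp ?P ?I (PiE {1..d} J) ?B"
    using \<open>d \<ge> 1\<close> A T kind by (rule linear_bsp_tensor_bsp)
  show "linear_fun ?I (PiE {1..d} J) (tensor_map d I f)"
    using comp by (intro linear_fun_tensor_map) (auto simp: computes_def)
  fix x assume x: "x \<in> free_space ?I"
  let ?in = "distribute ?P (local_idx ?B 0) (in_map ?B)"
  let ?out = "distribute ?P (local_idx ?B (num_steps ?B)) (out_map ?B)"
  \<comment> \<open>The distributed basis element is a pure tensor, its run factors over
    \<open>l\<close>, correctness of each \<open>A l\<close> evaluates the factors, and
    \<open>distribute_tensor_vec\<close> identifies their tensor with the distributed
    output.\<close>
  have basis: "run_bsp ?P ?B (num_steps ?B) (?in (indicator {k})) =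
      ?out (tensor_vec d (\<lambda>l. f l (indicator {k l})))" if k: "k \<in> ?I" for k
  proof -
    let ?X = "\<lambda>l. distribute (P l) (local_idx (A l) 0) (in_map (A l)) (indicator {k l})"
    have "?in (indicator {k}) = tensor_dist d P ?X"
      using k
      by (simp add: tensor_bsp_def indicator_eq_tensor_vec[of k d] PiE_iff
          distribute_tensor_vec[where L = "\<lambda>l. local_idx (A l) 0" and \<phi> = "\<lambda>l. in_map (A l)"]
          del: One_nat_def)
    then have "run_bsp ?P ?B (num_steps ?B) (?in (indicator {k})) =
        tensor_dist d P (\<lambda>l. run_bsp (P l) (A l) T (?X l))"
      using run_bsp_tensor_dist[OF \<open>d \<ge> 1\<close> A T kind distribute_in_dist_space order_refl]
      by (simp add: tensor_bsp_def)
    also have "\<dots> = tensor_dist d P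
        (\<lambda>l. distribute (P l) (local_idx (A l) T) (out_map (A l)) (f l (indicator {k l})))"
    proof (rule tensor_dist_cong)
      fix l assume l: "l \<in> {1..d}"
      then have "indicator {k l} \<in> free_space (I l)"
        using k by (auto simp: free_space_def indicator_def)
      then show "run_bsp (P l) (A l) T (?X l) =
          distribute (P l) (local_idx (A l) T) (out_map (A l)) (f l (indicator {k l}))"
        using comp[OF l] T[OF l] by (auto simp: computes_def)
    qed
    also have "\<dots> = ?out (tensor_vec d (\<lambda>l. f l (indicator {k l})))"
      by (simp add: tensor_bsp_def
          distribute_tensor_vec[where L = "\<lambda>l. local_idx (A l) T" and \<phi> = "\<lambda>l. out_map (A l)"]
          del: One_nat_def)
    finally show ?thesis .
  qed
  have fin: "finite ?I"
    using B by (simp add: linear_bsp_def)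
  \<comment> \<open>The coefficients \<open>x i\<close> of the basis expansion pass through
    distribution and run; the resulting combination of outputs is the defining sum of
    \<open>tensor_map\<close>.\<close>
  have "?in x = (\<lambda>s k. \<Sum>i\<in>?I. x i * ?in (indicator {i}) s k)"
    by (subst free_space_expand[OF fin x]) (rule distribute_sum)
  then have "run_bsp ?P ?B (num_steps ?B) (?in x) =
      (\<lambda>s k. \<Sum>i\<in>?I. x i * run_bsp ?P ?B (num_steps ?B) (?in (indicator {i})) s k)"
    using run_bsp_sum[OF B fin distribute_in_dist_space order_refl] by simp
  also have "\<dots> = (\<lambda>s k. \<Sum>i\<in>?I. x i * ?out (tensor_vec d (\<lambda>l. f l (indicator {i l}))) s k)"
    by (intro ext sum.cong refl) (simp only: basis)
  also have "\<dots> = ?out (tensor_map d I f x)"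
    unfolding tensor_map_def by (rule distribute_sum[symmetric])
  finally show "run_bsp ?P ?B (num_steps ?B) (?in x) = ?out (tensor_map d I f x)" .
qed

theorem theorem1:
  fixes d T :: nat
    and p :: "nat \<Rightarrow> nat"
    and I :: "nat \<Rightarrow> 'i set"
    and J :: "nat \<Rightarrow> 'j set"
    and A :: "nat \<Rightarrow> (nat, 'i, 'j, 'k) bsp_alg"
    and f :: "nat \<Rightarrow> ('i \<Rightarrow> complex) \<Rightarrow> 'j \<Rightarrow> complex"
  assumes "d \<ge> 1"
    and "\<And>l. l \<in> {1..d} \<Longrightarrow> p l \<ge> 1"
    and "\<And>l. l \<in> {1..d} \<Longrightarrow> computes {..<p l} (I l) (J l) (A l) (f l)"
    and "\<And>l. l \<in> {1..d} \<Longrightarrow> num_steps (A l) = T"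
    and "\<And>t. t < T \<Longrightarrow>
           (\<forall>l\<in>{1..d}. is_Comp (sstep (A l) t)) \<or> (\<forall>l\<in>{1..d}. is_Comm (sstep (A l) t))"
  shows "computes (PiE {1..d} (\<lambda>l. {..<p l})) (PiE {1..d} I) (PiE {1..d} J)
           (tensor_bsp d T A) (tensor_map d I f)"
  using assms(1,3,4,5) by (rule computes_tensor_bsp)

end
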